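(* Let $\mathcal V\subset\mathbb R^d$ be a finite set and consider the optimization problem $$C_{\mathcal V}=\max\left\{\Big|\bigcap_{v\in\mathcal V}H_v(c_v)\Big|:\ \vec c=(c_v)_{v\in\mathcal V}\in\mathbb R^{\mathcal V},\ \sum_{v\in\mathcal V}c_v=1\right\}.\qquad(P)$$ Then: 1. Problem $(P)$ has a finite maximum value if and only if $$\mathrm{Span}\,\mathcal V=\mathbb R^d\quad\text{and}\quad\sum_{v\in\mathcal V}v=0.\qquad(S)$$ 2. If $(S)$ holds and $\mathcal R_{\vec c}:=\bigcap_{v\in\mathcal V}H_v(c_v)$ is an optimizer of $(P)$, then $\mathcal R_{\vec c}+w$ is also an optimizer for each $w\in\mathbb R^d$.
   Context: $|\cdot|$ is Lebesgue measure on $\mathbb R^d$. For $v\in\mathbb R^d$ and $c\in\mathbb R$, $H_v(c):=\{p\in\mathbb R^d:\langle p,v\rangle\le c\}$. *)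

theory Defs
  imports "HOL-Analysis.Analysis"
begin

definition halfspace :: "real ^ 'd \<Rightarrow> real \<Rightarrow> (real ^ 'd) set" where
  "halfspace v c = {p. p \<bullet> v \<le> c}"

text \<open>A vector \<open>c \<in> \<real>\<^sup>V\<close> is a total function; only its values on \<open>V\<close> enter the definitions.\<close>

definition region :: "(real ^ 'd) set \<Rightarrow> (real ^ 'd \<Rightarrow> real) \<Rightarrow> (real ^ 'd) set" where
  "region V c = (\<Inter>v\<in>V. halfspace v (c v))"

definition feasible :: "(real ^ 'd) set \<Rightarrow> (real ^ 'd \<Rightarrow> real) \<Rightarrow> bool" where
  "feasible V c \<longleftrightarrow> (\<Sum>v\<in>V. c v) = 1"

text \<open>Volumes are taken in \<^typ>\<open>ennreal\<close>, since \<^term>\<open>measure lebesgue\<close> would assign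
  the value \<open>0\<close> to regions of infinite volume.\<close>

definition volumes :: "(real ^ 'd) set \<Rightarrow> ennreal set" where
  "volumes V = {emeasure lebesgue (region V c) | c. feasible V c}"

definition has_finite_maximum :: "(real ^ 'd) set \<Rightarrow> bool" where
  "has_finite_maximum V \<longleftrightarrow> (\<exists>m\<in>volumes V. m < \<infinity> \<and> (\<forall>x\<in>volumes V. x \<le> m))"

definition optimizer :: "(real ^ 'd) set \<Rightarrow> (real ^ 'd) set \<Rightarrow> bool" where
  "optimizer V R \<longleftrightarrow>
     (\<exists>c. feasible V c \<and> R = region V c) \<and> (\<forall>x\<in>volumes V. x \<le> emeasure lebesgue R)"

definition spanning_balanced :: "(real ^ 'd) set \<Rightarrow> bool" where
  "spanning_balanced V \<longleftrightarrow> span V = UNIV \<and> (\<Sum>v\<in>V. v) = 0"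

end

theory Submission
  imports Defs
begin

text \<open>
  The basic remark is that translating a region by \<open>w\<close> adds \<open>w \<bullet> v\<close> to each parameter \<open>c v\<close>, and
  therefore adds \<open>w \<bullet> (\<Sum>v\<in>V. v)\<close> to their sum. When \<open>\<Sum>v\<in>V. v = 0\<close> the constraint is thus
  translation invariant, and so is Lebesgue measure; this is the second claim
  (\<open>optimizer_translation\<close>).

  The same remark produces a maximum when in addition \<open>V\<close> spans. A nonempty feasible region can be
  translated so that it contains the origin, and then its parameters are nonnegative with sum \<open>1\<close>:
  only the standard simplex matters, which is compact. Since \<open>V\<close> spans and sums to \<open>0\<close>, every region
  is bounded, so the volume is finite; by continuity of measure from above it is an upper
  semicontinuous function of the parameters, hence it attains a maximum on the simplex
  (\<open>upper_semicontinuous_volume\<close>, \<open>simplex_volume_maximum\<close>).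

  Conversely, if \<open>\<Sum>v\<in>V. v \<noteq> 0\<close>, moving the centre far away in the direction opposite to this sum
  releases budget, and arbitrarily large balls fit into feasible regions
  (\<open>large_ball_in_feasible_region\<close>). If \<open>V\<close> is nonempty and does not span, some feasible
  region has nonempty interior, and it is invariant under translations orthogonal to \<open>V\<close>; it thus
  contains infinitely many disjoint balls of equal size (\<open>infinite_volume_of_not_spanning\<close>). If
  \<open>V\<close> is empty, no parameters are feasible, as an empty sum is not \<open>1\<close>.
\<close>

section \<open>Regions and their translates\<close>

lemma mem_region: "p \<in> region V c \<longleftrightarrow> (\<forall>v\<in>V. p \<bullet> v \<le> c v)"
  by (auto simp: region_def halfspace_def)

lemma closed_region: "closed (region V c)"
proof -
  have "closed (halfspace v a)" for v :: "real ^ 'd" and a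
    unfolding halfspace_def by (intro closed_Collect_le continuous_intros)
  then show ?thesis
    unfolding region_def by blast
qed

lemma region_borel [simp]: "region V c \<in> sets borel"
  by (simp add: closed_region borel_closed)

lemma region_translation:
  "(\<lambda>p. p + w) ` region V c = region V (\<lambda>v. c v + w \<bullet> v)"
proof
  show "region V (\<lambda>v. c v + w \<bullet> v) \<subseteq> (\<lambda>p. p + w) ` region V c"
  proof
    fix p assume "p \<in> region V (\<lambda>v. c v + w \<bullet> v)"
    then have "p - w \<in> region V c"
      by (simp add: mem_region inner_diff_left diff_le_eq)
    then show "p \<in> (\<lambda>p. p + w) ` region V c"
      by (metis diff_add_cancel image_eqI)
  qed
qed (auto simp: mem_region inner_add_left)

lemma feasible_translation:
  assumes "(\<Sum>v\<in>V. v) = 0"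
  shows "feasible V (\<lambda>v. c v + w \<bullet> v) \<longleftrightarrow> feasible V c"
  using assms by (simp add: feasible_def sum.distrib flip: inner_sum_right)

lemma emeasure_lebesgue_translation:
  "emeasure lebesgue ((\<lambda>p. p + w) ` S) = emeasure lebesgue (S :: 'a::euclidean_space set)"
  using emeasure_lebesgue_affine[of 1 w S] by (simp add: add.commute)

lemma optimizer_translation:
  assumes "(\<Sum>v\<in>V. v) = 0" and "optimizer V R"
  shows "optimizer V ((\<lambda>p. p + w) ` R)"
proof -
  obtain c where c: "feasible V c" "R = region V c"
    using assms(2) by (auto simp: optimizer_def)
  have "feasible V (\<lambda>v. c v + w \<bullet> v)"
    using c(1) feasible_translation[OF assms(1)] by blast
  moreover have "(\<lambda>p. p + w) ` R = region V (\<lambda>v. c v + w \<bullet> v)"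
    unfolding c(2) by (rule region_translation)
  ultimately show ?thesis
    using assms(2) unfolding optimizer_def emeasure_lebesgue_translation by blast
qed

section \<open>Necessity of the spanning and balancing conditions\<close>

lemma cball_subset_region:
  assumes "\<And>v. v \<in> V \<Longrightarrow> w \<bullet> v + r * norm v \<le> c v"
  shows "cball w r \<subseteq> region V c"
proof
  fix p assume "p \<in> cball w r"
  then have "norm (p - w) \<le> r"
    by (simp add: dist_norm norm_minus_commute)
  then have *: "norm (p - w) * norm v \<le> r * norm v" for v
    by (simp add: mult_right_mono)
  have "p \<bullet> v \<le> c v" if "v \<in> V" for v
  proof -
    have "p \<bullet> v = w \<bullet> v + (p - w) \<bullet> v"
      by (simp add: inner_diff_left)
    also have "\<dots> \<le> w \<bullet> v + r * norm v"
      using norm_cauchy_schwarz[of "p - w" v] *[of v] by linarith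
    also have "\<dots> \<le> c v"
      by (rule assms[OF that])
    finally show ?thesis .
  qed
  then show "p \<in> region V c"
    by (simp add: mem_region)
qed

lemma large_ball_in_feasible_region:
  assumes "(\<Sum>v\<in>V. v) \<noteq> 0"
  shows "\<exists>c w. feasible V c \<and> cball w r \<subseteq> region V c"
proof -
  define s where "s = (\<Sum>v\<in>V. v)"
  define w where "w = ((1 - r * (\<Sum>v\<in>V. norm v)) / (s \<bullet> s)) *\<^sub>R s"
  \<comment> \<open>The supporting values of the ball of radius \<open>r\<close> at \<open>w\<close>; the factor in \<open>w\<close> makes their sum \<open>1\<close>.\<close>
  define c where "c = (\<lambda>v. w \<bullet> v + r * norm v)"
  have "s \<noteq> 0"
    using assms by (simp add: s_def)
  have "(\<Sum>v\<in>V. c v) = w \<bullet> s + r * (\<Sum>v\<in>V. norm v)"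
    by (simp add: c_def s_def sum.distrib inner_sum_right sum_distrib_left)
  also have "\<dots> = 1"
    using \<open>s \<noteq> 0\<close> by (simp add: w_def)
  finally have "feasible V c"
    by (simp add: feasible_def)
  moreover have "cball w r \<subseteq> region V c"
    by (rule cball_subset_region) (simp add: c_def)
  ultimately show ?thesis
    by blast
qed

lemma ennreal_multiples_unbounded:
  assumes "b > 0" and "\<And>n::nat. ennreal (real n * b) \<le> m"
  shows "m = \<infinity>"
proof (rule ccontr)
  assume "m \<noteq> \<infinity>"
  then obtain x where x: "m = ennreal x" "x \<ge> 0"
    by (cases m) auto
  obtain n where "x < real n * b"
    using reals_Archimedean3[OF \<open>b > 0\<close>] by blast
  with assms(2)[of n] x show False
    by (simp add: ennreal_le_iff)
qed

lemma balanced_of_volumes_bounded: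
  fixes V :: "(real ^ 'd) set"
  assumes "m < \<infinity>" and bound: "\<And>c. feasible V c \<Longrightarrow> emeasure lebesgue (region V c) \<le> m"
  shows "(\<Sum>v\<in>V. v) = 0"
proof (rule ccontr)
  assume "(\<Sum>v\<in>V. v) \<noteq> 0"
  define b where "b = unit_ball_vol (CARD('d))"
  have "b > 0"
    by (simp add: b_def)
  have "ennreal (real n * b) \<le> m" for n
  proof -
    obtain c w where c: "feasible V c" "cball w (real n) \<subseteq> region V c"
      using large_ball_in_feasible_region[OF \<open>(\<Sum>v\<in>V. v) \<noteq> 0\<close>] by blast
    have "real n \<le> real n ^ CARD('d)"
      by (cases "n = 0") (auto intro: self_le_power)
    then have "real n * b \<le> b * real n ^ CARD('d)"
      using \<open>b > 0\<close> by (simp add: mult.commute)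
    then have "ennreal (real n * b) \<le> emeasure lebesgue (cball w (real n))"
      by (simp add: emeasure_cball b_def ennreal_leI)
    also have "\<dots> \<le> emeasure lebesgue (region V c)"
      by (rule emeasure_mono[OF c(2)]) simp
    also have "\<dots> \<le> m"
      by (rule bound[OF c(1)])
    finally show ?thesis .
  qed
  then have "m = \<infinity>"
    using ennreal_multiples_unbounded[OF \<open>b > 0\<close>] by blast
  with \<open>m < \<infinity>\<close> show False
    by simp
qed

lemma emeasure_infinite_of_ball_row:
  fixes S :: "'a::euclidean_space set"
  assumes "S \<in> sets lebesgue" and "r > 0" and "norm a \<ge> 2 * r"
    and balls: "\<And>k::nat. ball (real k *\<^sub>R a) r \<subseteq> S"
  shows "emeasure lebesgue S = \<infinity>"
proof -
  define B where "B = (\<lambda>k::nat. ball (real k *\<^sub>R a) r)"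
  define b where "b = unit_ball_vol (DIM('a)) * r ^ DIM('a)"
  have "b > 0"
    using \<open>r > 0\<close> by (simp add: b_def)
  have disj: "disjoint_family B"
  proof -
    have "B j \<inter> B k = {}" if "j \<noteq> k" for j k
      unfolding B_def
    proof (rule disjoint_ballI)
      have "1 \<le> \<bar>real j - real k\<bar>"
        using that by linarith
      then have "norm a \<le> \<bar>real j - real k\<bar> * norm a"
        by (simp add: mult_le_cancel_right1)
      also have "\<dots> = dist (real j *\<^sub>R a) (real k *\<^sub>R a)"
        by (simp add: dist_norm flip: scaleR_diff_left)
      finally show "r + r \<le> dist (real j *\<^sub>R a) (real k *\<^sub>R a)"
        using assms(3) by linarith
    qed
    then show ?thesis
      by (auto simp: disjoint_family_on_def)
  qed
  have "ennreal (real n * b) \<le> emeasure lebesgue S" for n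
  proof -
    have "(\<Sum>k<n. emeasure lebesgue (B k)) = emeasure lebesgue (\<Union>k<n. B k)"
      by (rule sum_emeasure) (use disj in \<open>auto simp: B_def disjoint_family_on_def\<close>)
    also have "\<dots> \<le> emeasure lebesgue S"
      using balls \<open>S \<in> sets lebesgue\<close> by (intro emeasure_mono) (auto simp: B_def)
    also have "(\<Sum>k<n. emeasure lebesgue (B k)) = ennreal (real n * b)"
      using \<open>r > 0\<close> \<open>b > 0\<close>
      by (simp add: B_def emeasure_ball ennreal_mult ennreal_of_nat_eq_real_of_nat flip: b_def)
    finally show ?thesis .
  qed
  then show ?thesis
    using ennreal_multiples_unbounded[OF \<open>b > 0\<close>] by blast
qed

text \<open>The sum of \<open>norm v + 1\<close>, rather than that of \<open>norm v\<close>, normalises the parameters below because it is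
  positive even for \<open>V = {0}\<close>.\<close>

lemma infinite_volume_of_not_spanning:
  fixes V :: "(real ^ 'd) set"
  assumes "finite V" "V \<noteq> {}" "span V \<noteq> UNIV"
  shows "\<exists>c. feasible V c \<and> emeasure lebesgue (region V c) = \<infinity>"
proof -
  define N where "N = (\<Sum>v\<in>V. norm v + 1)"
  have "N > 0"
    unfolding N_def using assms by (intro sum_pos) (auto intro: add_nonneg_pos)
  define c where "c = (\<lambda>v :: real ^ 'd. (norm v + 1) / N)"
  have "(\<Sum>v\<in>V. c v) = 1"
    using \<open>N > 0\<close> by (simp add: c_def N_def flip: sum_divide_distrib)
  then have "feasible V c"
    by (simp add: feasible_def)
  obtain a0 where a0: "a0 \<noteq> 0" "\<forall>x\<in>span V. a0 \<bullet> x = 0"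
    using span_not_UNIV_orthogonal[OF assms(3)] by blast
  define a where "a = (2 / N / norm a0) *\<^sub>R a0"
  have norm_a: "norm a = 2 * (1 / N)"
    using a0(1) \<open>N > 0\<close> by (simp add: a_def)
  have "a \<bullet> v = 0" if "v \<in> V" for v
    using a0(2) that by (simp add: a_def span_base)
  then have "cball (real k *\<^sub>R a) (1 / N) \<subseteq> region V c" for k
    using \<open>N > 0\<close> by (intro cball_subset_region) (simp add: c_def divide_simps)
  then have "emeasure lebesgue (region V c) = \<infinity>"
    using \<open>N > 0\<close> norm_a ball_subset_cball
    by (intro emeasure_infinite_of_ball_row[of _ "1 / N" a]) (simp, simp, simp, blast)
  with \<open>feasible V c\<close> show ?thesis
    by blast
qed

lemma spanning_balanced_of_finite_maximum:
  assumes "finite V" and "has_finite_maximum V"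
  shows "spanning_balanced V"
proof -
  obtain m where m: "m \<in> volumes V" "m < \<infinity>" "\<forall>x\<in>volumes V. x \<le> m"
    using assms(2) by (auto simp: has_finite_maximum_def)
  have bound: "emeasure lebesgue (region V c) \<le> m" if "feasible V c" for c
    using m(3) that by (auto simp: volumes_def)
  have "V \<noteq> {}"
    using m(1) by (auto simp: volumes_def feasible_def)
  have "span V = UNIV"
  proof (rule ccontr)
    assume "span V \<noteq> UNIV"
    then obtain c where "feasible V c" "emeasure lebesgue (region V c) = \<infinity>"
      using infinite_volume_of_not_spanning \<open>finite V\<close> \<open>V \<noteq> {}\<close> by blast
    then show False
      using bound[of c] m(2) by (simp add: top_unique)
  qed
  moreover have "(\<Sum>v\<in>V. v) = 0"
    using balanced_of_volumes_bounded[OF m(2) bound] by blast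
  ultimately show ?thesis
    by (simp add: spanning_balanced_def)
qed

section \<open>Existence of a maximum\<close>

text \<open>The vectors \<open>x\<close> such that \<open>p \<bullet> x\<close> is bounded for \<open>p \<in> S\<close> form a subspace; once it is the
  whole space, it contains the coordinate vectors.\<close>

lemma bounded_of_bounded_on_spanning_set:
  fixes S :: "'a::euclidean_space set"
  assumes "span V = UNIV" and V: "\<And>v. v \<in> V \<Longrightarrow> bounded ((\<lambda>p. p \<bullet> v) ` S)"
  shows "bounded S"
proof -
  have *: "bounded ((\<lambda>p. p \<bullet> x) ` S)" for x
  proof -
    have "x \<in> span V"
      using assms(1) by simp
    then show ?thesis
    proof (induction rule: span_induct_alt)
      case base
      then show ?case
        by (auto simp: bounded_iff)
    next
      case (step a v y)
      have "bounded ((\<lambda>p. a *\<^sub>R (p \<bullet> v)) ` S)"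
        using bounded_scaling[OF V[OF step(1)], of a] by (simp add: image_image)
      then show ?case
        using bounded_plus_comp[OF _ step(2)] by (simp add: inner_add_right)
    qed
  qed
  have "\<forall>b\<in>Basis. \<exists>B. \<forall>p\<in>S. \<bar>p \<bullet> b\<bar> \<le> B"
    using * by (auto simp: bounded_iff)
  then obtain B where B: "\<And>b p. b \<in> Basis \<Longrightarrow> p \<in> S \<Longrightarrow> \<bar>p \<bullet> b\<bar> \<le> B b"
    by metis
  have "norm p \<le> (\<Sum>b\<in>Basis. B b)" if "p \<in> S" for p
    using norm_le_l1[of p] sum_mono[of Basis "\<lambda>b. \<bar>p \<bullet> b\<bar>" B, OF B[OF _ that]] by linarith
  then show ?thesis
    by (auto simp: bounded_iff)
qed

text \<open>Upper bounds on all the \<open>p \<bullet> v\<close> also give lower bounds, because \<open>p \<bullet> v\<close> is minus the sum of the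
  others.\<close>

lemma bounded_region:
  fixes V :: "(real ^ 'd) set"
  assumes "finite V" and "spanning_balanced V"
  shows "bounded (region V c)"
proof (rule bounded_of_bounded_on_spanning_set)
  show "span V = UNIV"
    using assms(2) by (simp add: spanning_balanced_def)
  fix v assume v: "v \<in> V"
  have "\<bar>p \<bullet> v\<bar> \<le> \<bar>c v\<bar> + \<bar>\<Sum>u\<in>V - {v}. c u\<bar>" if p: "p \<in> region V c" for p
  proof -
    have "0 = p \<bullet> (\<Sum>u\<in>V. u)"
      using assms(2) by (simp add: spanning_balanced_def)
    also have "\<dots> = p \<bullet> v + (\<Sum>u\<in>V - {v}. p \<bullet> u)"
      using v \<open>finite V\<close> by (simp add: inner_sum_right inner_add_right sum.remove)
    also have "\<dots> \<le> p \<bullet> v + (\<Sum>u\<in>V - {v}. c u)"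
      using p by (intro add_left_mono sum_mono) (auto simp: mem_region)
    finally have "- (p \<bullet> v) \<le> (\<Sum>u\<in>V - {v}. c u)"
      by linarith
    moreover have "p \<bullet> v \<le> c v"
      using p v by (simp add: mem_region)
    ultimately show ?thesis
      by linarith
  qed
  then show "bounded ((\<lambda>p. p \<bullet> v) ` region V c)"
    unfolding bounded_iff by (auto simp: real_norm_def)
qed

lemma emeasure_region_finite:
  fixes V :: "(real ^ 'd) set"
  assumes "finite V" and "spanning_balanced V"
  shows "emeasure lebesgue (region V c) < \<infinity>"
  using emeasure_bounded_finite[OF bounded_region[OF assms, of c]] by simp

text \<open>The region with parameters \<open>c\<close> is the decreasing intersection of the regions with parameters
  \<open>c + 1/n\<close>, and each of these contains all regions with parameters close to \<open>c\<close>.\<close>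

lemma upper_semicontinuous_volume:
  fixes V :: "(real ^ 'd) set"
  assumes "finite V" and "spanning_balanced V"
  shows "open {c. emeasure lebesgue (region V c) < a}"
proof (subst open_subopen, clarify)
  fix c :: "real ^ 'd \<Rightarrow> real"
  assume c: "emeasure lebesgue (region V c) < a"
  define A where "A = (\<lambda>n::nat. region V (\<lambda>v. c v + inverse (real (Suc n))))"
  have "(\<Inter>n. A n) = region V c"
  proof -
    have "(\<forall>n. x \<le> y + inverse (real (Suc n))) \<longleftrightarrow> x \<le> y" for x y :: real
    proof
      assume *: "\<forall>n. x \<le> y + inverse (real (Suc n))"
      show "x \<le> y"
      proof (rule ccontr)
        assume "\<not> x \<le> y"
        then obtain n where "inverse (real (Suc n)) < x - y"
          using reals_Archimedean[of "x - y"] by auto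
        with * show False
          by (metis add.commute less_diff_eq not_le)
      qed
    qed (auto intro: add_increasing2)
    then show ?thesis
      unfolding A_def set_eq_iff INT_iff mem_region by blast
  qed
  moreover have "decseq A"
  proof (rule decseq_SucI)
    fix n
    have "inverse (real (Suc (Suc n))) \<le> inverse (real (Suc n))"
      by (intro le_imp_inverse_le) auto
    then show "A (Suc n) \<subseteq> A n"
      unfolding A_def mem_region subset_iff by (meson add_left_mono order_trans)
  qed
  then have "(INF n. emeasure lebesgue (A n)) = emeasure lebesgue (\<Inter>n. A n)"
    using emeasure_region_finite[OF assms]
    by (intro INF_emeasure_decseq) (auto simp: A_def less_top)
  ultimately have "(INF n. emeasure lebesgue (A n)) < a"
    using c by simp
  then obtain n where n: "emeasure lebesgue (A n) < a"
    by (auto simp: INF_less_iff)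
  define U where "U = (\<Inter>v\<in>V. {c'. c' v < c v + inverse (real (Suc n))})"
  have "open U"
    unfolding U_def using \<open>finite V\<close>
    by (intro open_INT open_Collect_less ballI continuous_on_product_coordinates) auto
  moreover have "c \<in> U"
    by (simp add: U_def)
  moreover have "U \<subseteq> {c. emeasure lebesgue (region V c) < a}"
  proof
    fix c' assume "c' \<in> U"
    then have "region V c' \<subseteq> A n"
      unfolding U_def A_def by (force simp: mem_region)
    then have "emeasure lebesgue (region V c') \<le> emeasure lebesgue (A n)"
      by (rule emeasure_mono) (simp add: A_def)
    with n show "c' \<in> {c. emeasure lebesgue (region V c) < a}"
      by simp
  qed
  ultimately show "\<exists>T. open T \<and> c \<in> T \<and> T \<subseteq> {c. emeasure lebesgue (region V c) < a}"
    by blast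
qed

text \<open>Otherwise the sets \<open>{x. f x < f y}\<close> cover \<open>K\<close>, and a finite subcover has a maximal \<open>f y\<close>; but
  that \<open>y\<close> lies in no member of the subcover.\<close>

lemma upper_semicontinuous_attains_sup:
  fixes f :: "'a::topological_space \<Rightarrow> 'b::linorder"
  assumes "compact K" "K \<noteq> {}" and op: "\<And>a. open {x. f x < a}"
  shows "\<exists>x\<in>K. \<forall>y\<in>K. f y \<le> f x"
proof (rule ccontr)
  assume "\<not> ?thesis"
  then have "K \<subseteq> (\<Union>y\<in>K. {x. f x < f y})"
    by (force simp: not_le)
  then obtain F where F: "F \<subseteq> K" "finite F" "K \<subseteq> (\<Union>y\<in>F. {x. f x < f y})"
    using compactE_image[OF \<open>compact K\<close>, of K "\<lambda>y. {x. f x < f y}"] op by blast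
  have "F \<noteq> {}"
    using F(3) \<open>K \<noteq> {}\<close> by auto
  then have "Max (f ` F) \<in> f ` F"
    using F(2) by (intro Max_in) auto
  then obtain z where z: "z \<in> F" "f z = Max (f ` F)"
    by force
  then obtain y where y: "y \<in> F" "f z < f y"
    using F(1,3) by blast
  have "f y \<le> f z"
    using z(2) F(2) y(1) by simp
  with y(2) show False
    by simp
qed

text \<open>Requiring \<open>c v = 0\<close> outside \<open>V\<close> is what makes this set of total functions compact.\<close>

definition parameter_simplex :: "'a set \<Rightarrow> ('a \<Rightarrow> real) set" where
  "parameter_simplex V =
     {c. (\<forall>v\<in>V. 0 \<le> c v) \<and> (\<forall>v. v \<notin> V \<longrightarrow> c v = 0) \<and> (\<Sum>v\<in>V. c v) = 1}"

lemma compact_parameter_simplex: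
  assumes "finite V"
  shows "compact (parameter_simplex V)"
proof -
  define Q where "Q = PiE UNIV (\<lambda>v. if v \<in> V then {0..1} else {0::real})"
  have "compactin (product_topology (\<lambda>v. euclidean) UNIV) Q"
    unfolding Q_def by (subst compactin_PiE) auto
  then have "compact Q"
    by (simp add: euclidean_product_topology)
  moreover have "closed {c. (\<Sum>v\<in>V. c v) = (1::real)}"
    by (intro closed_Collect_eq continuous_on_sum continuous_on_product_coordinates) auto
  moreover have "parameter_simplex V = Q \<inter> {c. (\<Sum>v\<in>V. c v) = 1}"
  proof -
    have "c v \<le> 1" if "\<forall>v\<in>V. 0 \<le> c v" "(\<Sum>v\<in>V. c v) = 1" "v \<in> V" for c :: "'a \<Rightarrow> real" and v
      using member_le_sum[OF that(3), of c] that assms by auto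
    then show ?thesis
      by (auto simp: parameter_simplex_def Q_def PiE_iff split: if_splits)
  qed
  ultimately show ?thesis
    by (simp add: compact_Int_closed)
qed

lemma parameter_simplex_nonempty:
  assumes "finite V" "V \<noteq> {}"
  shows "parameter_simplex V \<noteq> {}"
proof -
  obtain u where "u \<in> V"
    using assms(2) by blast
  then have "(\<lambda>v. if v = u then 1 else 0) \<in> parameter_simplex V"
    using assms(1) by (auto simp: parameter_simplex_def)
  then show ?thesis
    by blast
qed

lemma simplex_volume_maximum:
  fixes V :: "(real ^ 'd) set"
  assumes "finite V" and "spanning_balanced V"
  shows "\<exists>c\<in>parameter_simplex V. \<forall>c'\<in>parameter_simplex V.
    emeasure lebesgue (region V c') \<le> emeasure lebesgue (region V c)"
proof (rule upper_semicontinuous_attains_sup)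
  show "compact (parameter_simplex V)"
    by (rule compact_parameter_simplex[OF assms(1)])
  have "V \<noteq> {}"
  proof
    assume "V = {}"
    then have "UNIV = {0 :: real ^ 'd}"
      using assms(2) by (simp add: spanning_balanced_def)
    then have "(1 :: real ^ 'd) = 0"
      by blast
    then show False
      by simp
  qed
  then show "parameter_simplex V \<noteq> {}"
    using parameter_simplex_nonempty assms(1) by blast
qed (rule upper_semicontinuous_volume[OF assms])

lemma volume_eq_simplex_volume:
  assumes "(\<Sum>v\<in>V. v) = 0" "feasible V c" "region V c \<noteq> {}"
  shows "\<exists>c'\<in>parameter_simplex V.
    emeasure lebesgue (region V c') = emeasure lebesgue (region V c)"
proof -
  obtain p where p: "p \<in> region V c"
    using assms(3) by blast
  define c1 where "c1 = (\<lambda>v. c v + (- p) \<bullet> v)"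
  define c' where "c' = (\<lambda>v. if v \<in> V then c1 v else 0)"
  have "feasible V c1"
    unfolding c1_def using feasible_translation[OF assms(1)] assms(2) by blast
  moreover have "0 \<le> c1 v" if "v \<in> V" for v
    using p that by (simp add: c1_def mem_region)
  ultimately have "c' \<in> parameter_simplex V"
    by (simp add: parameter_simplex_def c'_def feasible_def)
  moreover have "region V c' = region V c1"
    by (auto simp: mem_region c'_def)
  then have "region V c' = (\<lambda>q. q + (- p)) ` region V c"
    unfolding c1_def by (simp only: region_translation)
  then have "emeasure lebesgue (region V c') = emeasure lebesgue (region V c)"
    by (simp only: emeasure_lebesgue_translation)
  ultimately show ?thesis
    by blast
qed

lemma finite_maximum_of_spanning_balanced:
  fixes V :: "(real ^ 'd) set"
  assumes "finite V" and "spanning_balanced V"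
  shows "has_finite_maximum V"
proof -
  obtain c where c: "c \<in> parameter_simplex V"
    and max: "\<And>c'. c' \<in> parameter_simplex V \<Longrightarrow>
      emeasure lebesgue (region V c') \<le> emeasure lebesgue (region V c)"
    using simplex_volume_maximum[OF assms] by blast
  have "feasible V c"
    using c by (simp add: parameter_simplex_def feasible_def)
  then have "emeasure lebesgue (region V c) \<in> volumes V"
    by (auto simp: volumes_def)
  moreover have "x \<le> emeasure lebesgue (region V c)" if x: "x \<in> volumes V" for x
  proof -
    obtain d where d: "feasible V d" "x = emeasure lebesgue (region V d)"
      using x by (auto simp: volumes_def)
    show ?thesis
    proof (cases "region V d = {}")
      case True
      then show ?thesis
        using d(2) by simp
    next
      case False
      have "(\<Sum>v\<in>V. v) = 0"
        using assms(2) by (simp add: spanning_balanced_def)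
      then obtain d' where "d' \<in> parameter_simplex V" "emeasure lebesgue (region V d') = x"
        using volume_eq_simplex_volume[OF _ d(1) False] d(2) by auto
      then show ?thesis
        using max[of d'] by simp
    qed
  qed
  ultimately show ?thesis
    unfolding has_finite_maximum_def using emeasure_region_finite[OF assms, of c] by blast
qed

section \<open>The characterisation\<close>

theorem lemma3p1:
  fixes V :: "(real ^ 'd) set"
  assumes "finite V"
  shows "(has_finite_maximum V \<longleftrightarrow> spanning_balanced V) \<and>
    (spanning_balanced V \<longrightarrow>
      (\<forall>c w. optimizer V (region V c) \<longrightarrow> optimizer V ((\<lambda>p. p + w) ` region V c)))"
proof (intro conjI impI allI)
  show "has_finite_maximum V \<longleftrightarrow> spanning_balanced V"
    using spanning_balanced_of_finite_maximum[OF assms]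
      finite_maximum_of_spanning_balanced[OF assms] by blast
  fix c w
  assume "spanning_balanced V" and opt: "optimizer V (region V c)"
  then have "(\<Sum>v\<in>V. v) = 0"
    by (simp add: spanning_balanced_def)
  then show "optimizer V ((\<lambda>p. p + w) ` region V c)"
    using opt by (rule optimizer_translation)
qed

end
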